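(* For every constant $k\ge 2$ there are graphs $G$ on an arbitrarily large number $n$ of nodes, together with a connected $k$-node graph $H$, such that (i) the induced copies of $H$ form a fraction $p_H = 1/\mathrm{poly}(n) = \Omega(n^{1-k})$ of all induced connected $k$-node subgraphs of $G$, and (ii) any algorithm that accesses $G$ only through calls $\mathrm{sample}(T)$, where $T$ is a $k$-node tree of its choice and each call returns an independent uniformly random (not necessarily induced) copy of $T$ in $G$, needs $\Omega(1/p_H)$ calls in expectation before obtaining a single copy of $H$ (i.e. a returned tree whose vertex set induces a subgraph isomorphic to $H$).
   Context: A graphlet copy of $G$ is a set of $k$ vertices inducing a connected subgraph; an induced copy of $H$ is a set of $k$ vertices whose induced subgraph is isomorphic to $H$. A copy of a tree $T$ in $G$ is a subgraph of $G$ isomorphic to $T$. *)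

theory Defs
  imports "HOL-Probability.Probability" "HOL-Library.Landau_Symbols"
begin

datatype 'v ugraph = UGraph (verts: "'v set") (edges: "'v set set")

definition simple_graph :: "'v ugraph \<Rightarrow> bool" where
  "simple_graph G \<longleftrightarrow> finite (verts G) \<and> (\<forall>e\<in>edges G. e \<subseteq> verts G \<and> card e = 2)"

definition connected_graph :: "'v ugraph \<Rightarrow> bool" where
  "connected_graph G \<longleftrightarrow> verts G \<noteq> {} \<and>
     (\<forall>u\<in>verts G. \<forall>v\<in>verts G. (u, v) \<in> {(x, y). {x, y} \<in> edges G}\<^sup>*)"

definition cycle_in :: "'v ugraph \<Rightarrow> 'v list \<Rightarrow> bool" where
  "cycle_in G xs \<longleftrightarrow> 3 \<le> length xs \<and> distinct xs \<and>
     (\<forall>i<length xs. {xs ! i, xs ! (Suc i mod length xs)} \<in> edges G)"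

definition tree_graph :: "'v ugraph \<Rightarrow> bool" where
  "tree_graph T \<longleftrightarrow> simple_graph T \<and> connected_graph T \<and> (\<nexists>xs. cycle_in T xs)"

definition isomorphic :: "'v ugraph \<Rightarrow> 'w ugraph \<Rightarrow> bool" where
  "isomorphic G H \<longleftrightarrow> (\<exists>f. bij_betw f (verts G) (verts H) \<and>
     (\<forall>u\<in>verts G. \<forall>v\<in>verts G. {u, v} \<in> edges G \<longleftrightarrow> {f u, f v} \<in> edges H))"

definition subgraph :: "'v ugraph \<Rightarrow> 'v ugraph \<Rightarrow> bool" where
  "subgraph S G \<longleftrightarrow> simple_graph S \<and> verts S \<subseteq> verts G \<and> edges S \<subseteq> edges G"

definition induced :: "'v ugraph \<Rightarrow> 'v set \<Rightarrow> 'v ugraph" where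
  "induced G V = UGraph V {e \<in> edges G. e \<subseteq> V}"

definition graphlet_copies :: "nat \<Rightarrow> 'v ugraph \<Rightarrow> 'v set set" where
  "graphlet_copies k G = {V. V \<subseteq> verts G \<and> card V = k \<and> connected_graph (induced G V)}"

definition induced_copies :: "'w ugraph \<Rightarrow> 'v ugraph \<Rightarrow> 'v set set" where
  "induced_copies H G = {V. V \<subseteq> verts G \<and> isomorphic (induced G V) H}"

definition frequency :: "'w ugraph \<Rightarrow> 'v ugraph \<Rightarrow> real" where
  "frequency H G = real (card (induced_copies H G)) / real (card (graphlet_copies (card (verts H)) G))"

definition tree_copies :: "'w ugraph \<Rightarrow> 'v ugraph \<Rightarrow> 'v ugraph set" where
  "tree_copies T G = {S. subgraph S G \<and> isomorphic S T}"

text \<open>The answer is \<open>None\<close> if there is no copy to be returned.\<close>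

definition sample :: "'v ugraph \<Rightarrow> 'w ugraph \<Rightarrow> 'v ugraph option pmf" where
  "sample G T = (if tree_copies T G = {} then return_pmf None
                 else map_pmf Some (pmf_of_set (tree_copies T G)))"

text \<open>Since the distribution of an answer depends only on the isomorphism class of the requested
  tree, requests are trees on the vertex set \<open>{..<k}\<close>.\<close>

definition ktrees :: "nat \<Rightarrow> nat ugraph set" where
  "ktrees k = {T. tree_graph T \<and> verts T = {..<k}}"

text \<open>The calls made so far, oldest first, with their answers.\<close>

type_synonym transcript = "(nat ugraph \<times> nat ugraph option) list"

text \<open>A randomized adaptive algorithm: from a random seed, drawn once from \<open>R\<close>, and the transcript
  it determines the next tree to be sampled. There is no halting: going on after a premature halt
  could only shorten the wait for the first success, and calls after that one do not count.\<close>

definition sampling_algorithm ::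
    "nat \<Rightarrow> real measure \<Rightarrow> (real \<Rightarrow> transcript \<Rightarrow> nat ugraph) \<Rightarrow> bool" where
  "sampling_algorithm k R A \<longleftrightarrow> prob_space R \<and>
     (\<forall>r\<in>space R. \<forall>h. A r h \<in> ktrees k) \<and>
     (\<forall>h. (\<lambda>r. A r h) \<in> R \<rightarrow>\<^sub>M count_space UNIV)"

text \<open>\<open>X (i, T)\<close> is the answer to call number \<open>i\<close> (from \<open>0\<close>) in case this call requests \<open>T\<close>; the
  answers to requests that are not made are never revealed to the algorithm.\<close>

primrec transcript ::
    "(transcript \<Rightarrow> nat ugraph) \<Rightarrow> (nat \<times> nat ugraph \<Rightarrow> nat ugraph option) \<Rightarrow> nat \<Rightarrow> transcript" where
  "transcript a X 0 = []"
| "transcript a X (Suc i) =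
     (let h = transcript a X i; T = a h in h @ [(T, X (i, T))])"

definition answer_space :: "nat ugraph \<Rightarrow> (nat \<times> nat ugraph \<Rightarrow> nat ugraph option) measure" where
  "answer_space G = PiM UNIV (\<lambda>(i, T). measure_pmf (sample G T))"

definition is_hit :: "'v ugraph \<Rightarrow> 'w ugraph \<Rightarrow> 'v ugraph option \<Rightarrow> bool" where
  "is_hit G H answer \<longleftrightarrow> (\<exists>S. answer = Some S \<and> isomorphic (induced G (verts S)) H)"

text \<open>The number of calls up to and including the first one that yields a copy of \<open>H\<close>;
  it is \<open>\<infinity>\<close> (the infimum of the empty set) if there is none.\<close>

definition calls_until_hit ::
    "nat ugraph \<Rightarrow> 'w ugraph \<Rightarrow> (transcript \<Rightarrow> nat ugraph) \<Rightarrow>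
     (nat \<times> nat ugraph \<Rightarrow> nat ugraph option) \<Rightarrow> ennreal" where
  "calls_until_hit G H a X =
     (INF m \<in> {m. 0 < m \<and> is_hit G H (snd (last (transcript a X m)))}. of_nat m)"

definition expected_calls ::
    "nat ugraph \<Rightarrow> 'w ugraph \<Rightarrow> real measure \<Rightarrow> (real \<Rightarrow> transcript \<Rightarrow> nat ugraph) \<Rightarrow> ennreal" where
  "expected_calls G H R A =
     (\<integral>\<^sup>+ (r, X). calls_until_hit G H (A r) X \<partial>(R \<Otimes>\<^sub>M answer_space G))"

end

theory Submission imports Defs
begin

text \<open>For \<open>k \<ge> 3\<close> let \<open>G\<close> be the complete graph on \<open>n\<close> vertices without the edge \<open>{0, 1}\<close>, and \<open>H\<close>
  the complete graph on \<open>k\<close> vertices without one edge. All \<open>k\<close>-sets of vertices are connected, and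
  the induced copies of \<open>H\<close> are those containing 0 and 1, so
  \<open>p\<^sub>H = k (k - 1) / (n (n - 1))\<close>. Every tree \<open>T\<close> has a copy on each \<open>k\<close>-set that avoids 0 and 1, hence
  a number of copies of the order of \<open>n choose k\<close>, whereas each induced copy of \<open>H\<close> spans a number
  of copies of \<open>T\<close> bounded in terms of \<open>k\<close>. So every call, whatever tree it requests, succeeds with
  probability \<open>q = O(p\<^sub>H)\<close>, and by a union bound the first \<open>1 / (2 q)\<close> calls all fail with
  probability at least 1/2. For \<open>k = 2\<close> every graphlet is an edge, \<open>p\<^sub>H = 1\<close>, and complete graphs
  will do.\<close>

section \<open>Transcripts and the product space of answers\<close>

lemma length_transcript [simp]: "length (transcript a X i) = i"
  by (induction i) (auto simp: Let_def)

text \<open>Describes the event that \<open>h\<close> is the transcript by finitely many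
  coordinates: the strategy must choose the recorded requests, and each requested coordinate must
  carry the recorded answer. Measurability and the product formula both rest on this form.\<close>

lemma transcript_eq_iff:
  "transcript a X (length h) = h \<longleftrightarrow>
     (\<forall>j<length h. a (take j h) = fst (h ! j) \<and> X (j, fst (h ! j)) = snd (h ! j))"
proof (induction h rule: rev_induct)
  case (snoc z h)
  show ?case
    using snoc.IH by (cases z) (auto simp: Let_def less_Suc_eq nth_append)
qed simp

lemma sampling_algorithm_ktrees:
  "sampling_algorithm k R A \<Longrightarrow> r \<in> space R \<Longrightarrow> A r h \<in> ktrees k"
  by (simp add: sampling_algorithm_def)

lemma finite_ktrees: "finite (ktrees k)"
proof (rule finite_subset)
  show "ktrees k \<subseteq> UGraph {..<k} ` Pow (Pow {..<k})"
  proof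
    fix T assume T: "T \<in> ktrees k"
    then have "edges T \<subseteq> Pow {..<k}"
      by (auto simp: ktrees_def tree_graph_def simple_graph_def)
    with T show "T \<in> UGraph {..<k} ` Pow (Pow {..<k})"
      by (cases T) (auto simp: ktrees_def)
  qed
qed simp

lemma finite_tree_copies:
  assumes "simple_graph G"
  shows "finite (tree_copies T G)"
proof (rule finite_subset)
  show "tree_copies T G \<subseteq> (\<lambda>(V, E). UGraph V E) ` (Pow (verts G) \<times> Pow (Pow (verts G)))"
  proof
    fix S assume S: "S \<in> tree_copies T G"
    then have "verts S \<subseteq> verts G" "edges S \<subseteq> Pow (verts G)"
      by (auto simp: tree_copies_def subgraph_def simple_graph_def)
    then show "S \<in> (\<lambda>(V, E). UGraph V E) ` (Pow (verts G) \<times> Pow (Pow (verts G)))"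
      by (cases S) auto
  qed
  show "finite ((\<lambda>(V, E). UGraph V E) ` (Pow (verts G) \<times> Pow (Pow (verts G))))"
    using assms by (simp add: simple_graph_def)
qed

lemma finite_set_pmf_sample: "simple_graph G \<Longrightarrow> finite (set_pmf (sample G T))"
  by (simp add: sample_def finite_tree_copies)

lemma prob_space_answer_space: "prob_space (answer_space G)"
  unfolding answer_space_def
  by (intro prob_space_PiM) (auto simp: measure_pmf.prob_space_axioms)

lemma space_answer_space [simp]: "space (answer_space G) = UNIV"
  by (auto simp: answer_space_def space_PiM split_def)

lemma measurable_answer [measurable]:
  "(\<lambda>X. X (i, T)) \<in> answer_space G \<rightarrow>\<^sub>M count_space UNIV"
proof -
  have "(\<lambda>X. X (i, T)) \<in> answer_space G \<rightarrow>\<^sub>M measure_pmf (sample G T)"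
    using measurable_component_singleton[of "(i, T)" UNIV "\<lambda>(i, T). measure_pmf (sample G T)"]
    by (simp add: answer_space_def)
  then show ?thesis
    by (rule measurable_compose[where g = "\<lambda>x. x"]) simp
qed

text \<open>Together with the finiteness of \<open>ktrees k\<close> and of the supports, this leaves
  almost surely only finitely many transcripts of each length.\<close>

lemma AE_answer_in_set_pmf: "AE X in answer_space G. X (i, T) \<in> set_pmf (sample G T)"
  unfolding answer_space_def
  using AE_PiM_component[of UNIV "\<lambda>(i, T). measure_pmf (sample G T)" "(i, T)"
      "\<lambda>x. x \<in> set_pmf (sample G T)"]
  by (auto simp: measure_pmf.prob_space_axioms AE_measure_pmf)

text \<open>For a fixed strategy a transcript of length \<open>i\<close> constrains only finitely many answers, all
  of them to calls before number \<open>i\<close>; so the next answer is independent of it.\<close>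

lemma emeasure_transcript_hit_le:
  assumes "measure (sample G (a h)) S \<le> q"
  shows "emeasure (answer_space G) {X. transcript a X (length h) = h \<and> X (length h, a h) \<in> S}
      \<le> ennreal q * emeasure (answer_space G) {X. transcript a X (length h) = h}"
proof (cases "\<forall>j<length h. a (take j h) = fst (h ! j)")
  case False
  \<comment> \<open>The strategy \<open>a\<close> never makes the requests recorded in
    \<open>h\<close>, so both events are empty.\<close>
  then have "\<not> transcript a X (length h) = h" for X
    by (auto simp: transcript_eq_iff)
  then show ?thesis by simp
next
  case True
  let ?M = "\<lambda>(i, T). measure_pmf (sample G T)"
  interpret product_prob_space ?M UNIV
    by (intro product_prob_spaceI) (auto simp: measure_pmf.prob_space_axioms)
  \<comment> \<open>\<open>J\<close> holds the coordinates revealed by \<open>h\<close>, and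
    \<open>B\<close> forces the recorded answers on them. The other branch of \<open>B\<close>
    serves \<open>?x\<close>, whose index \<open>length h\<close> exceeds all indices in
    \<open>J\<close>; hence its factor splits off the product.\<close>
  define J where "J = (\<lambda>j. (j, fst (h ! j))) ` {..<length h}"
  define B where "B = (\<lambda>(j, T :: nat ugraph). if j < length h then {snd (h ! j)} else S)"
  let ?x = "(length h, a h)"
  have J: "finite J" "?x \<notin> J"
    by (auto simp: J_def)
  have cyl: "emeasure (answer_space G) {X. \<forall>x\<in>K. X x \<in> B x} = (\<Prod>x\<in>K. emeasure (?M x) (B x))"
    if "finite K" for K
  proof -
    have "B x \<in> sets (?M x)" for x
      by (cases x) simp
    then show ?thesis
      using emeasure_PiM_Collect[of K B] that space_answer_space[of G, unfolded answer_space_def]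
      by (simp add: answer_space_def)
  qed
  have tr: "transcript a X (length h) = h \<longleftrightarrow> (\<forall>x\<in>J. X x \<in> B x)" for X
    using True by (auto simp: transcript_eq_iff J_def B_def)
  have "emeasure (answer_space G) {X. transcript a X (length h) = h \<and> X ?x \<in> S} =
      emeasure (answer_space G) {X. \<forall>x\<in>insert ?x J. X x \<in> B x}"
    unfolding tr by (intro arg_cong[where f = "emeasure _"]) (auto simp: B_def)
  also have "\<dots> = emeasure (sample G (a h)) S * (\<Prod>x\<in>J. emeasure (?M x) (B x))"
    using J by (subst cyl) (auto simp: B_def)
  also have "\<dots> \<le> ennreal q * (\<Prod>x\<in>J. emeasure (?M x) (B x))"
    using assms by (intro mult_right_mono) (auto simp: measure_pmf.emeasure_eq_measure ennreal_leI)
  finally show ?thesis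
    unfolding tr using J by (simp add: cyl)
qed

section \<open>From hit probabilities to the expected number of calls\<close>

text \<open>Integrating over the seed and summing over the disjoint transcript events bounds the hit
  probability of each single call by \<open>q\<close>. The 4 is a product: a wait of at least
  \<open>1 / (2 * q)\<close> with probability at least 1/2.\<close>

lemma expected_calls_ge:
  assumes alg: "sampling_algorithm k R A"
    and G: "simple_graph G"
    and q: "q > 0" "\<And>T. T \<in> ktrees k \<Longrightarrow> measure (sample G T) (Collect (is_hit G H)) \<le> q"
  shows "expected_calls G H R A \<ge> ennreal (1 / (4 * q))"
proof -
  let ?Q = "answer_space G"
  let ?M = "R \<Otimes>\<^sub>M ?Q"
  interpret R: prob_space R using alg by (simp add: sampling_algorithm_def)
  interpret Q: prob_space ?Q by (rule prob_space_answer_space)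
  interpret P: pair_prob_space R ?Q ..
  have A [measurable]: "(\<lambda>r. A r h) \<in> R \<rightarrow>\<^sub>M count_space UNIV" for h
    using alg by (simp add: sampling_algorithm_def)
  \<comment> \<open>Graphs, and hence transcripts, form an uncountable type. Only the finitely many transcripts with
    answers in the supports matter almost surely, and each of these is a measurable event.\<close>
  define Hs where
    "Hs i = {h. set h \<subseteq> (SIGMA T : ktrees k. set_pmf (sample G T)) \<and> length h = i}" for i
  have fin: "finite (Hs i)" for i
    unfolding Hs_def
    by (intro finite_lists_length_eq finite_SigmaI finite_ktrees finite_set_pmf_sample G)
  \<comment> \<open>\<open>E h\<close> says that \<open>h\<close> is the transcript after
    \<open>length h\<close> calls; \<open>D h\<close> adds that the next call is a hit.\<close>
  define E where "E h = {z \<in> space ?M. transcript (A (fst z)) (snd z) (length h) = h}" for h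
  define D where "D h = {z \<in> E h. is_hit G H (snd z (length h, A (fst z) h))}" for h
  have E_sets [measurable]: "E h \<in> sets ?M" for h
    unfolding E_def transcript_eq_iff by measurable
  \<comment> \<open>The coordinate read in \<open>D h\<close> depends on the seed. Splitting by the
    requested tree gives a finite union in which each set reads a fixed coordinate.\<close>
  have "D h = E h \<inter> (\<Union>T\<in>ktrees k. {z \<in> space ?M. A (fst z) h = T \<and> snd z (length h, T) \<in> Collect (is_hit G H)})" for h
    unfolding D_def E_def using sampling_algorithm_ktrees[OF alg]
    by (auto simp: space_pair_measure)
  moreover have "{z \<in> space ?M. A (fst z) h = T \<and> snd z (length h, T) \<in> Collect (is_hit G H)} \<in> sets ?M" for h T
  proof -
    have [measurable]: "Measurable.pred (count_space UNIV) (is_hit G H)"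
      by simp
    show ?thesis
      unfolding mem_Collect_eq by measurable
  qed
  ultimately have D_sets: "D h \<in> sets ?M" for h
    by (auto intro!: sets.finite_UN finite_ktrees)
  have D_le: "emeasure ?M (D h) \<le> ennreal q * emeasure ?M (E h)" for h
  proof -
    \<comment> \<open>By Fubini the seed can be fixed first, which leaves a deterministic
      strategy.\<close>
    have "emeasure ?M (D h) = (\<integral>\<^sup>+r. emeasure ?Q (Pair r -` D h) \<partial>R)"
      by (rule Q.emeasure_pair_measure_alt[OF D_sets])
    also have "\<dots> \<le> (\<integral>\<^sup>+r. ennreal q * emeasure ?Q (Pair r -` E h) \<partial>R)"
    proof (rule nn_integral_mono)
      fix r assume r: "r \<in> space R"
      then have "Pair r -` D h = {X. transcript (A r) X (length h) = h \<and> X (length h, A r h) \<in> Collect (is_hit G H)}"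
        "Pair r -` E h = {X. transcript (A r) X (length h) = h}"
        by (auto simp: D_def E_def space_pair_measure)
      then show "emeasure ?Q (Pair r -` D h) \<le> ennreal q * emeasure ?Q (Pair r -` E h)"
        using emeasure_transcript_hit_le[OF q(2)[OF sampling_algorithm_ktrees[OF alg r]]] by simp
    qed
    also have "\<dots> = ennreal q * emeasure ?M (E h)"
      by (subst nn_integral_cmult) (auto simp: Q.emeasure_pair_measure_alt Q.measurable_emeasure_Pair)
    finally show ?thesis .
  qed
  define B where "B i = (\<Union>h\<in>Hs i. D h)" for i
  have B_sets [measurable]: "B i \<in> sets ?M" for i
    unfolding B_def by (intro sets.finite_UN fin D_sets)
  have B_le: "emeasure ?M (B i) \<le> ennreal q" for i
  proof -
    have "emeasure ?M (B i) \<le> (\<Sum>h\<in>Hs i. emeasure ?M (D h))"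
      unfolding B_def by (intro emeasure_subadditive_finite) (auto simp: fin D_sets)
    also have "\<dots> \<le> (\<Sum>h\<in>Hs i. ennreal q * emeasure ?M (E h))"
      by (intro sum_mono D_le)
    also have "\<dots> = ennreal q * (\<Sum>h\<in>Hs i. emeasure ?M (E h))"
      by (simp add: sum_distrib_left)
    \<comment> \<open>A run has only one transcript of length \<open>i\<close>, so these events are
      disjoint and no factor for the number of transcripts arises.\<close>
    also have "(\<Sum>h\<in>Hs i. emeasure ?M (E h)) = emeasure ?M (\<Union>h\<in>Hs i. E h)"
    proof (rule sum_emeasure)
      show "disjoint_family_on E (Hs i)"
        by (auto simp: disjoint_family_on_def Hs_def E_def)
    qed (auto simp: fin)
    also have "\<dots> \<le> 1"
      by (rule P.emeasure_le_1)
    finally show ?thesis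
      by (simp add: mult_left_mono)
  qed
  \<comment> \<open>Rounding down keeps the union bound \<open>N * q\<close> at most 1/2; failing in
    \<open>N\<close> calls means waiting for \<open>N + 1\<close>, which is again at least
    \<open>1 / (2 * q)\<close>.\<close>
  define N where "N = nat \<lfloor>1 / (2 * q)\<rfloor>"
  have "real N = of_int \<lfloor>1 / (2 * q)\<rfloor>"
    using q(1) by (simp add: N_def)
  then have N: "real N \<le> 1 / (2 * q)" "1 / (2 * q) \<le> real N + 1"
    by linarith+
  define U where "U = (\<Union>i<N. B i)"
  have U_sets: "U \<in> sets ?M"
    unfolding U_def by measurable
  have "emeasure ?M U \<le> (\<Sum>i<N. emeasure ?M (B i))"
    unfolding U_def by (intro emeasure_subadditive_finite) auto
  also have "\<dots> \<le> (\<Sum>i<N. ennreal q)"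
    by (intro sum_mono B_le)
  also have "\<dots> = ennreal (real N * q)"
    using q(1) by (simp add: ennreal_mult ennreal_of_nat_eq_real_of_nat)
  also have "\<dots> \<le> ennreal (1 / 2)"
    using N(1) q(1) by (intro ennreal_leI) (simp add: field_simps)
  finally have "P.prob U \<le> 1 / 2"
    unfolding P.emeasure_eq_measure by (subst (asm) ennreal_le_iff) auto
  then have U_compl: "1 / 2 \<le> P.prob (space ?M - U)"
    using P.prob_compl[OF U_sets] by simp
  have ae: "AE z in ?M. \<forall>i<N. \<forall>T\<in>ktrees k. snd z (i, T) \<in> set_pmf (sample G T)"
  proof -
    have "AE z in ?M. snd z (i, T) \<in> set_pmf (sample G T)" for i T
      by (rule P.AE_pair_measure) (use AE_answer_in_set_pmf in auto)
    then show ?thesis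
      by (simp add: AE_all_countable AE_ball_countable countable_finite finite_ktrees)
  qed
  \<comment> \<open>The wait is compared with a simple function, whose integral is explicit;
    monotonicity of the nonnegative integral asks only for this inequality almost
    everywhere.\<close>
  have le: "AE z in ?M. of_nat (Suc N) * indicator (space ?M - U) z \<le>
      (case z of (r, X) \<Rightarrow> calls_until_hit G H (A r) X)"
    using ae AE_space
  proof eventually_elim
    case (elim z)
    obtain r X where z: "z = (r, X)" by (cases z)
    have r: "r \<in> space R" using elim z by (simp add: space_pair_measure)
    have Hs: "transcript (A r) X i \<in> Hs i" if "i \<le> N" for i
      using that elim(1) z
    proof (induction i)
      case (Suc i)
      then show ?case
        using sampling_algorithm_ktrees[OF alg r] by (auto simp: Hs_def Let_def)
    qed (simp add: Hs_def)
    have "Suc N \<le> m" if "z \<notin> U" "0 < m" "is_hit G H (snd (last (transcript (A r) X m)))" for m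
    proof (rule ccontr)
      assume "\<not> Suc N \<le> m"
      \<comment> \<open>Calls are numbered from 0, so the last entry of a transcript of length
        \<open>Suc i\<close> is call \<open>i\<close>, made after seeing the transcript of length
        \<open>i\<close>.\<close>
      with that obtain i where i: "m = Suc i" "i < N" by (cases m) auto
      then have "z \<in> D (transcript (A r) X i)"
        using that elim(2) z by (auto simp: D_def E_def Let_def)
      then have "z \<in> U"
        using Hs[of i] i by (auto simp: U_def B_def)
      with that show False by simp
    qed
    then show ?case
      unfolding z calls_until_hit_def
      by (auto simp: indicator_def z simp del: of_nat_Suc intro!: INF_greatest)
  qed
  have "1 / (4 * q) = 1 / (2 * q) * (1 / 2)"
    by simp
  also have "\<dots> \<le> real (Suc N) * P.prob (space ?M - U)"
    using N(2) q(1) U_compl by (intro mult_mono) auto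
  finally have "ennreal (1 / (4 * q)) \<le> ennreal (real (Suc N) * P.prob (space ?M - U))"
    by (rule ennreal_leI)
  also have "\<dots> = of_nat (Suc N) * emeasure ?M (space ?M - U)"
    by (simp add: ennreal_mult P.emeasure_eq_measure ennreal_of_nat_eq_real_of_nat del: of_nat_Suc)
  also have "\<dots> = (\<integral>\<^sup>+z. of_nat (Suc N) * indicator (space ?M - U) z \<partial>?M)"
    using U_sets by (subst nn_integral_cmult_indicator) auto
  also have "\<dots> \<le> expected_calls G H R A"
    unfolding expected_calls_def by (rule nn_integral_mono_AE[OF le])
  finally show ?thesis .
qed

section \<open>Complete graphs with edges removed\<close>

text \<open>The parameter \<open>F\<close> lets one family supply both \<open>G\<close> and
  \<open>H\<close>, with \<open>F\<close> empty for \<open>k = 2\<close> and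
  \<open>F = {{0, 1}}\<close> for larger \<open>k\<close>.\<close>

definition complete_minus :: "nat \<Rightarrow> nat set set \<Rightarrow> nat ugraph" where
  "complete_minus n F = UGraph {..<n} ({e. e \<subseteq> {..<n} \<and> card e = 2} - F)"

lemma verts_complete_minus [simp]: "verts (complete_minus n F) = {..<n}"
  by (simp add: complete_minus_def)

lemma in_edges_complete_minus:
  "{u, v} \<in> edges (complete_minus n F) \<longleftrightarrow> u < n \<and> v < n \<and> u \<noteq> v \<and> {u, v} \<notin> F"
  by (auto simp: complete_minus_def card_2_iff doubleton_eq_iff)

lemma simple_graph_complete_minus: "simple_graph (complete_minus n F)"
  by (simp add: simple_graph_def complete_minus_def)

lemma edges_induced: "{u, v} \<in> edges (induced G V) \<longleftrightarrow> {u, v} \<in> edges G \<and> u \<in> V \<and> v \<in> V"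
  by (simp add: induced_def)

lemma verts_induced [simp]: "verts (induced G V) = V"
  by (simp add: induced_def)

lemma induced_verts:
  assumes "simple_graph G"
  shows "induced G (verts G) = G"
  using assms by (cases G) (auto simp: induced_def simple_graph_def)

lemma card_verts_isomorphic: "isomorphic G H \<Longrightarrow> card (verts G) = card (verts H)"
  by (auto simp: isomorphic_def bij_betw_same_card)

lemma card_induced_copy: "V \<in> induced_copies H G \<Longrightarrow> card V = card (verts H)"
  by (auto simp: induced_copies_def dest: card_verts_isomorphic)

section \<open>Graphlet copies and induced copies\<close>

lemma connected_induced_complete:
  assumes "V \<subseteq> {..<n}" "V \<noteq> {}"
  shows "connected_graph (induced (complete_minus n {}) V)"
  unfolding connected_graph_def
proof (intro conjI ballI)
  fix u v assume "u \<in> verts (induced (complete_minus n {}) V)" "v \<in> verts (induced (complete_minus n {}) V)"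
  then show "(u, v) \<in> {(x, y). {x, y} \<in> edges (induced (complete_minus n {}) V)}\<^sup>*"
    using assms by (cases "u = v") (auto simp: edges_induced in_edges_complete_minus)
qed (use assms in simp)

text \<open>Only one pair can be nonadjacent, and any third vertex of \<open>V\<close> is adjacent
  to both of its ends.\<close>

lemma connected_induced_complete_minus_edge:
  assumes V: "V \<subseteq> {..<n}" "3 \<le> card V"
  shows "connected_graph (induced (complete_minus n {{a, b}}) V)"
  unfolding connected_graph_def
proof (intro conjI ballI)
  let ?R = "{(x, y). {x, y} \<in> edges (induced (complete_minus n {{a, b}}) V)}"
  have edge: "(x, y) \<in> ?R" if "x \<in> V" "y \<in> V" "x \<noteq> y" "{x, y} \<noteq> {a, b}" for x y
    using that V by (auto simp: edges_induced in_edges_complete_minus)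
  fix u v
  assume "u \<in> verts (induced (complete_minus n {{a, b}}) V)"
    "v \<in> verts (induced (complete_minus n {{a, b}}) V)"
  then have uv: "u \<in> V" "v \<in> V" by simp_all
  show "(u, v) \<in> ?R\<^sup>*"
  proof (cases "u = v \<or> {u, v} \<noteq> {a, b}")
    case True
    with edge[of u v] uv show ?thesis by auto
  next
    case False
    have "\<not> V \<subseteq> {u, v}"
      using V card_mono[of "{u, v}" V] card_insert_le_m1[of 2 "{v}" u] by auto
    then obtain w where "w \<in> V" "w \<noteq> u" "w \<noteq> v" by auto
    moreover from this have "{u, w} \<noteq> {a, b}" "{w, v} \<noteq> {a, b}"
      using False unfolding doubleton_eq_iff by metis+
    ultimately have "(u, w) \<in> ?R" "(w, v) \<in> ?R"
      using uv by (metis edge)+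
    then show ?thesis by (rule converse_rtrancl_into_rtrancl[OF _ r_into_rtrancl])
  qed
qed (use assms in auto)

lemma graphlet_copies_eq:
  assumes "\<And>V. V \<subseteq> verts G \<Longrightarrow> card V = k \<Longrightarrow> connected_graph (induced G V)"
  shows "graphlet_copies k G = {V. V \<subseteq> verts G \<and> card V = k}"
  using assms by (auto simp: graphlet_copies_def)

lemma induced_copies_complete:
  "induced_copies (complete_minus k {}) (complete_minus n {}) = {V. V \<subseteq> {..<n} \<and> card V = k}"
proof -
  have "isomorphic (induced (complete_minus n {}) V) (complete_minus k {})"
    if V: "V \<subseteq> {..<n}" "card V = k" for V
  proof -
    obtain f where f: "bij_betw f V {..<k}"
      using V by (metis card_lessThan finite_lessThan finite_same_card_bij finite_subset)
    then show ?thesis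
      using V unfolding isomorphic_def
      by (intro exI[of _ f])
         (auto simp: edges_induced in_edges_complete_minus bij_betw_def inj_on_def)
  qed
  then show ?thesis
    by (auto simp: induced_copies_def dest: card_verts_isomorphic)
qed

text \<open>An isomorphism pulls the missing edge of \<open>H\<close> back to a nonadjacent pair of
  \<open>V\<close>, which can only be \<open>{0, 1}\<close>. Conversely, any bijection that fixes 0
  and 1 matches the missing edges.\<close>

lemma induced_copies_complete_minus_edge:
  assumes "2 \<le> k"
  shows "induced_copies (complete_minus k {{0, 1}}) (complete_minus n {{0, 1}}) =
    {V. V \<subseteq> {..<n} \<and> card V = k \<and> 0 \<in> V \<and> 1 \<in> V}"
proof -
  let ?G = "complete_minus n {{0, 1}}" and ?H = "complete_minus k {{0, 1}}"
  have "0 \<in> V \<and> 1 \<in> V" if V: "V \<subseteq> {..<n}" and *: "isomorphic (induced ?G V) ?H" for V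
  proof -
    obtain f where f: "bij_betw f V {..<k}"
      and iso: "\<And>u v. u \<in> V \<Longrightarrow> v \<in> V \<Longrightarrow> {u, v} \<in> edges (induced ?G V) \<longleftrightarrow> {f u, f v} \<in> edges ?H"
      using * by (auto simp: isomorphic_def)
    have "0 \<in> f ` V" "1 \<in> f ` V"
      using f assms by (auto simp: bij_betw_def)
    then obtain u v where uv: "u \<in> V" "v \<in> V" "f u = 0" "f v = 1" by auto
    then have "u \<noteq> v" by auto
    have "{f u, f v} \<notin> edges ?H"
      unfolding in_edges_complete_minus uv by simp
    then have "{u, v} \<notin> edges ?G"
      using iso[of u v] uv by (simp add: edges_induced)
    moreover have "u < n" "v < n" using uv V by auto
    ultimately have "{u, v} = {0, 1}"
      using \<open>u \<noteq> v\<close> by (simp add: in_edges_complete_minus)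
    then have "{0, 1} \<subseteq> V"
      using uv by (metis empty_subsetI insert_subset)
    then show ?thesis by simp
  qed
  moreover have "isomorphic (induced ?G V) ?H"
    if V: "V \<subseteq> {..<n}" "card V = k" "0 \<in> V" "1 \<in> V" for V
  proof -
    have fin: "finite V" using V(1) finite_subset by blast
    have "card (V - {0, 1}) = card {2..<k}"
      using V by (simp add: card_Diff_subset)
    then obtain g where g: "bij_betw g (V - {0, 1}) {2..<k}"
      using fin by (metis finite_Diff finite_atLeastLessThan finite_same_card_bij)
    define f where "f x = (if x \<in> {0, 1} then x else g x)" for x :: nat
    have "bij_betw f ({0, 1} \<union> (V - {0, 1})) ({0, 1} \<union> {2..<k})"
    proof (rule bij_betw_combine)
      show "bij_betw f {0, 1} {0, 1}"
        by (auto simp: bij_betw_def f_def)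
      show "bij_betw f (V - {0, 1}) {2..<k}"
        using g by (subst bij_betw_cong[of _ f g]) (auto simp: f_def)
    qed auto
    moreover have "{0, 1} \<union> (V - {0, 1}) = V" "{0, 1} \<union> {2..<k} = {..<k}"
      using V assms by auto
    ultimately have f: "bij_betw f V {..<k}" by simp
    have missing: "{u, v} = {0, 1} \<longleftrightarrow> {f u, f v} = {0, 1}" if "u \<in> V" "v \<in> V" for u v
    proof -
      have "f 0 = 0" "f 1 = 1" by (auto simp: f_def)
      then have "x = 0 \<longleftrightarrow> f x = 0" "x = 1 \<longleftrightarrow> f x = 1" if "x \<in> V" for x
        using f V that by (metis bij_betw_def inj_on_eq_iff)+
      then show ?thesis
        using that by (auto simp: doubleton_eq_iff)
    qed
    have "{u, v} \<in> edges (induced ?G V) \<longleftrightarrow> {f u, f v} \<in> edges ?H" if "u \<in> V" "v \<in> V" for u v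
    proof -
      have "u < n" "v < n" "f u < k" "f v < k" "f u = f v \<longleftrightarrow> u = v"
        using f V that by (auto simp: bij_betw_def inj_on_def)
      then show ?thesis
        using missing[OF that] that unfolding edges_induced in_edges_complete_minus by simp
    qed
    then show ?thesis
      using f by (auto simp: isomorphic_def)
  qed
  ultimately show ?thesis
    by (auto simp: induced_copies_def dest: card_verts_isomorphic)
qed

text \<open>Removing 0 and 1 is a bijection onto the \<open>k - 2\<close>-subsets of
  \<open>{2..<n}\<close>.\<close>

lemma card_subsets_containing_two:
  assumes "2 \<le> k" "2 \<le> n"
  shows "card {V. V \<subseteq> {..<n} \<and> card V = k \<and> 0 \<in> V \<and> 1 \<in> V} = (n - 2) choose (k - 2)"
proof -
  let ?S = "{W. W \<subseteq> {2..<n} \<and> card W = k - 2}"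
  have fin: "finite W" if "W \<subseteq> {m..<n}" for m W
    using that finite_subset by blast
  have "bij_betw (\<lambda>W. W \<union> {0, 1}) ?S {V. V \<subseteq> {..<n} \<and> card V = k \<and> 0 \<in> V \<and> 1 \<in> V}"
  proof (rule bij_betw_byWitness[where f' = "\<lambda>V. V - {0, 1}"])
    show "(\<lambda>W. W \<union> {0, 1}) ` ?S \<subseteq> {V. V \<subseteq> {..<n} \<and> card V = k \<and> 0 \<in> V \<and> 1 \<in> V}"
    proof safe
      fix W assume W: "W \<subseteq> {2..<n}" "card W = k - 2"
      then have "card (W \<union> {0, 1}) = card W + card {0 :: nat, 1}"
        using fin[OF W(1)] by (intro card_Un_disjoint) auto
      with W assms show "card (W \<union> {0, 1}) = k" by simp
    qed (use assms in auto)
    show "(\<lambda>V. V - {0, 1}) ` {V. V \<subseteq> {..<n} \<and> card V = k \<and> 0 \<in> V \<and> 1 \<in> V} \<subseteq> ?S"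
      by (auto simp: card_Diff_subset)
  qed auto
  then have "card {V. V \<subseteq> {..<n} \<and> card V = k \<and> 0 \<in> V \<and> 1 \<in> V} = card ?S"
    by (simp add: bij_betw_same_card)
  also have "\<dots> = (n - 2) choose (k - 2)"
    using n_subsets[of "{2..<n}" "k - 2"] by simp
  finally show ?thesis .
qed

section \<open>Tree copies and the probability of a hit\<close>

text \<open>A hit is determined by its vertex set, an induced copy of \<open>H\<close>, and its edge
  set, one of the \<open>2 ^ 2 ^ k\<close> sets of subsets of those \<open>k\<close> vertices. This
  crude factor depends on \<open>k\<close> alone.\<close>

lemma card_hit_trees_le:
  assumes G: "simple_graph G" and k: "\<And>V. V \<in> induced_copies H G \<Longrightarrow> card V = k"
  shows "card {S \<in> tree_copies T G. is_hit G H (Some S)} \<le> card (induced_copies H G) * 2 ^ 2 ^ k"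
proof -
  have fin: "finite (induced_copies H G)"
    using G by (auto simp: induced_copies_def simple_graph_def intro: finite_subset[of _ "Pow (verts G)"])
  have finV: "finite V" if "V \<in> induced_copies H G" for V
    using that G finite_subset by (auto simp: induced_copies_def simple_graph_def)
  have "{S \<in> tree_copies T G. is_hit G H (Some S)} \<subseteq>
      (\<Union>V\<in>induced_copies H G. UGraph V ` Pow (Pow V))"
  proof safe
    fix S assume "S \<in> tree_copies T G" "is_hit G H (Some S)"
    then have "verts S \<in> induced_copies H G" "edges S \<subseteq> Pow (verts S)"
      by (auto simp: induced_copies_def tree_copies_def subgraph_def is_hit_def simple_graph_def)
    then show "S \<in> (\<Union>V\<in>induced_copies H G. UGraph V ` Pow (Pow V))"
      by (cases S) auto
  qed
  then have "card {S \<in> tree_copies T G. is_hit G H (Some S)} \<le>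
      card (\<Union>V\<in>induced_copies H G. UGraph V ` Pow (Pow V))"
    using fin finV by (intro card_mono) auto
  also have "\<dots> \<le> (\<Sum>V\<in>induced_copies H G. card (UGraph V ` Pow (Pow V)))"
    by (rule card_UN_le[OF fin])
  also have "\<dots> \<le> (\<Sum>V\<in>induced_copies H G. 2 ^ 2 ^ k)"
  proof (rule sum_mono)
    fix V assume V: "V \<in> induced_copies H G"
    have "card (UGraph V ` Pow (Pow V)) \<le> card (Pow (Pow V))"
      using finV[OF V] by (intro card_image_le) simp
    also have "\<dots> = 2 ^ 2 ^ k"
      using finV[OF V] k[OF V] by (simp add: card_Pow)
    finally show "card (UGraph V ` Pow (Pow V)) \<le> 2 ^ 2 ^ k" .
  qed
  finally show ?thesis by simp
qed

text \<open>A bijection from \<open>V\<close> to \<open>{..<k}\<close> pulls \<open>T\<close> back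
  to a tree on \<open>V\<close>; its edges are pairs in \<open>V\<close>, all of which are edges of
  \<open>G\<close>.\<close>

lemma exists_copy_in_complete_part:
  assumes T: "T \<in> ktrees k" and V: "card V = k" "V \<subseteq> verts G" "finite V"
    and complete: "\<And>e. e \<subseteq> V \<Longrightarrow> card e = 2 \<Longrightarrow> e \<in> edges G"
  shows "\<exists>S\<in>tree_copies T G. verts S = V"
proof -
  have T': "verts T = {..<k}" "\<And>e. e \<in> edges T \<Longrightarrow> e \<subseteq> {..<k} \<and> card e = 2"
    using T by (auto simp: ktrees_def tree_graph_def simple_graph_def)
  obtain f where f: "bij_betw f V {..<k}"
    using V by (metis card_lessThan finite_lessThan finite_same_card_bij)
  define S where "S = UGraph V {e. e \<subseteq> V \<and> f ` e \<in> edges T}"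
  have inj: "inj_on f V" using f by (simp add: bij_betw_def)
  have card: "card e = 2" if "e \<in> edges S" for e
  proof -
    have "e \<subseteq> V" "card (f ` e) = 2" using that T' by (auto simp: S_def)
    with inj show ?thesis by (metis card_image inj_on_subset)
  qed
  then have "simple_graph S"
    using V by (auto simp: simple_graph_def S_def)
  moreover have "edges S \<subseteq> edges G"
    using card complete by (auto simp: S_def)
  moreover have "isomorphic S T"
    unfolding isomorphic_def using f T' by (intro exI[of _ f]) (auto simp: S_def)
  ultimately have "S \<in> tree_copies T G" "verts S = V"
    using V by (auto simp: tree_copies_def subgraph_def S_def)
  then show ?thesis by blast
qed

text \<open>The \<open>k\<close>-subsets of \<open>{2..<n}\<close> avoid the missing edge, so each
  is the vertex set of some copy, and distinct vertex sets belong to distinct copies.\<close>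

lemma card_tree_copies_complete_minus_edge:
  assumes "T \<in> ktrees k"
  shows "(n - 2) choose k \<le> card (tree_copies T (complete_minus n {{0, 1}}))"
proof -
  let ?G = "complete_minus n {{0, 1}}"
  have fin: "finite (tree_copies T ?G)"
    by (intro finite_tree_copies simple_graph_complete_minus)
  have "{V. V \<subseteq> {2..<n} \<and> card V = k} \<subseteq> verts ` tree_copies T ?G"
  proof safe
    fix V assume V: "V \<subseteq> {2..<n}" "k = card V"
    have "\<exists>S\<in>tree_copies T ?G. verts S = V"
    proof (rule exists_copy_in_complete_part[OF assms])
      show "finite V" using V(1) finite_subset by blast
      show "e \<in> edges ?G" if "e \<subseteq> V" "card e = 2" for e
        using that V(1) by (force simp: complete_minus_def)
    qed (use V in auto)
    then show "V \<in> verts ` tree_copies T ?G" by auto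
  qed
  then have "card {V. V \<subseteq> {2..<n} \<and> card V = k} \<le> card (tree_copies T ?G)"
    using fin by (meson card_image_le card_mono finite_imageI order_trans)
  then show ?thesis
    using n_subsets[of "{2..<n}" k] by simp
qed

lemma prob_hit_le:
  assumes G: "simple_graph G" and k: "\<And>V. V \<in> induced_copies H G \<Longrightarrow> card V = k"
    and m: "0 < m" "m \<le> card (tree_copies T G)"
  shows "measure (sample G T) (Collect (is_hit G H)) \<le>
    2 ^ 2 ^ k * real (card (induced_copies H G)) / real m"
proof -
  have fin: "finite (tree_copies T G)" by (rule finite_tree_copies[OF G])
  have ne: "tree_copies T G \<noteq> {}" using m by auto
  have "measure (sample G T) (Collect (is_hit G H)) =
      real (card {S \<in> tree_copies T G. is_hit G H (Some S)}) / real (card (tree_copies T G))"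
    using fin ne by (simp add: sample_def measure_pmf_of_set vimage_def Int_def)
  also have "\<dots> \<le> real (card (induced_copies H G) * 2 ^ 2 ^ k) / real m"
    using m card_hit_trees_le[OF G k, where T = T] by (intro frac_le of_nat_mono) auto
  finally show ?thesis by (simp add: mult.commute)
qed

section \<open>Binomial estimates and the frequency of the pattern\<close>

lemma binomial_minus_2:
  assumes "2 \<le> k" "2 \<le> n"
  shows "k * (k - 1) * (n choose k) = n * (n - 1) * ((n - 2) choose (k - 2))"
proof -
  have "k * (n choose k) = n * ((n - 1) choose (k - 1))"
    using assms by (intro times_binomial_minus1_eq) simp
  moreover have "(k - 1) * ((n - 1) choose (k - 1)) = (n - 1) * ((n - 2) choose (k - 2))"
    using times_binomial_minus1_eq[of "k - 1" "n - 1"] assms by (simp add: numeral_2_eq_2)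
  ultimately show ?thesis
    by (metis mult.assoc mult.left_commute)
qed

text \<open>Removing one of \<open>m\<close> points scales the count by \<open>(m - k) / m\<close>,
  which is at least 1/2 in this range; two removals cost at most a factor 4.\<close>

lemma binomial_le_4_binomial_minus_2:
  assumes "2 * k + 2 \<le> n"
  shows "n choose k \<le> 4 * ((n - 2) choose k)"
proof -
  have step: "m choose k \<le> 2 * ((m - 1) choose k)" if "2 * k + 1 \<le> m" for m
  proof -
    have "m * (m choose k) \<le> (2 * (m - k)) * (m choose k)"
      using that by (intro mult_right_mono) auto
    also have "\<dots> = m * (2 * ((m - 1) choose k))"
      using binomial_absorb_comp[of m k] by simp
    finally show ?thesis using that by simp
  qed
  have "n choose k \<le> 2 * ((n - 1) choose k)"
    using assms by (intro step) simp
  also have "(n - 1) choose k \<le> 2 * ((n - 2) choose k)"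
    using step[of "n - 1"] assms by (simp add: numeral_2_eq_2)
  finally show ?thesis by simp
qed

lemma frequency_complete:
  assumes "0 < k" "k \<le> n"
  shows "frequency (complete_minus k {}) (complete_minus n {}) = 1"
proof -
  have "graphlet_copies k (complete_minus n {}) = {V. V \<subseteq> {..<n} \<and> card V = k}"
    using assms by (subst graphlet_copies_eq) (auto intro!: connected_induced_complete)
  then show ?thesis
    using assms n_subsets[of "{..<n}" k]
    by (simp add: frequency_def induced_copies_complete binomial_eq_0_iff)
qed

lemma frequency_complete_minus_edge:
  assumes "3 \<le> k" "k \<le> n"
  shows "frequency (complete_minus k {{0, 1}}) (complete_minus n {{0, 1}}) =
    real ((n - 2) choose (k - 2)) / real (n choose k)"
proof -
  have "graphlet_copies k (complete_minus n {{0, 1}}) = {V. V \<subseteq> {..<n} \<and> card V = k}"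
    using assms by (subst graphlet_copies_eq) (auto intro!: connected_induced_complete_minus_edge)
  then show ?thesis
    using assms n_subsets[of "{..<n}" k]
      induced_copies_complete_minus_edge[of k n] card_subsets_containing_two[of k n]
    by (simp add: frequency_def)
qed

text \<open>By \<open>binomial_minus_2\<close> the frequency is
  \<open>k * (k - 1) / (n * (n - 1))\<close>, and \<open>n * (n - 1)\<close> lies between
  \<open>n ^ 2 / 2\<close> and \<open>n ^ 2\<close>.\<close>

lemma frequency_complete_minus_edge_bounds:
  assumes "3 \<le> k" "k \<le> n"
  defines "p \<equiv> frequency (complete_minus k {{0, 1}}) (complete_minus n {{0, 1}})"
  shows "1 / real n ^ 2 \<le> p" "p \<le> 2 * real k ^ 2 / real n ^ 2"
proof -
  have "real (k * (k - 1)) * real (n choose k) = real (n * (n - 1)) * real ((n - 2) choose (k - 2))"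
    using binomial_minus_2[of k n] assms(1,2) unfolding of_nat_mult[symmetric] of_nat_eq_iff by simp
  moreover have "real (n choose k) > 0"
    using assms by simp
  ultimately have p: "p = real (k * (k - 1)) / real (n * (n - 1))"
    using assms unfolding p_def frequency_complete_minus_edge[OF assms(1,2)]
    by (simp add: field_simps)
  have "1 \<le> k * (k - 1)" "n * (n - 1) \<le> n ^ 2"
    using assms by (auto simp: power2_eq_square)
  then have "real 1 \<le> real (k * (k - 1))" "real (n * (n - 1)) \<le> real (n ^ 2)" "0 < real (n * (n - 1))"
    using assms unfolding of_nat_le_iff by auto
  then show "1 / real n ^ 2 \<le> p"
    unfolding p by (intro frac_le) (simp_all del: of_nat_mult)
  have "k * (k - 1) \<le> k ^ 2" "n ^ 2 \<le> 2 * (n * (n - 1))"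
    using assms by (auto simp: power2_eq_square)
  then have "real (k * (k - 1)) \<le> real (k ^ 2)" "real (n ^ 2) / 2 \<le> real (n * (n - 1))"
    unfolding of_nat_le_iff by linarith+
  then have "p \<le> real (k ^ 2) / (real (n ^ 2) / 2)"
    unfolding p using assms by (intro frac_le) (simp_all del: of_nat_mult)
  then show "p \<le> 2 * real k ^ 2 / real n ^ 2"
    by (simp add: mult.commute)
qed

text \<open>The factor \<open>2 ^ 2 ^ k\<close> counts edge sets per induced copy; the 4 pays for
  replacing \<open>(n - 2) choose k\<close> by \<open>n choose k\<close>, the number of graphlet
  copies.\<close>

lemma prob_hit_complete_minus_edge_le:
  assumes "3 \<le> k" "2 * k + 2 \<le> n" "T \<in> ktrees k"
  defines "G \<equiv> complete_minus n {{0, 1}}" and "H \<equiv> complete_minus k {{0, 1}}"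
  shows "measure (sample G T) (Collect (is_hit G H)) \<le> 4 * 2 ^ 2 ^ k * frequency H G"
proof -
  have pos: "0 < (n - 2) choose k" "0 < n choose k"
    using assms by auto
  have "measure (sample G T) (Collect (is_hit G H)) \<le>
      2 ^ 2 ^ k * real (card (induced_copies H G)) / real ((n - 2) choose k)"
    unfolding G_def H_def using assms pos
    by (intro prob_hit_le simple_graph_complete_minus card_tree_copies_complete_minus_edge)
       (auto dest: card_induced_copy)
  also have "\<dots> \<le> 2 ^ 2 ^ k * real (card (induced_copies H G)) / (real (n choose k) / 4)"
  proof (intro divide_left_mono)
    have "real (n choose k) \<le> real (4 * ((n - 2) choose k))"
      using binomial_le_4_binomial_minus_2[OF assms(2)] unfolding of_nat_le_iff .
    then show "real (n choose k) / 4 \<le> real ((n - 2) choose k)"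
      by simp
  qed (use pos in auto)
  also have "card (induced_copies H G) = (n - 2) choose (k - 2)"
    using assms induced_copies_complete_minus_edge[of k n] card_subsets_containing_two[of k n]
    by (simp add: G_def H_def)
  finally show ?thesis
    using frequency_complete_minus_edge[of k n] assms by (simp add: G_def H_def mult_ac)
qed

section \<open>Asymptotics and assembly\<close>

lemma bigtheta_bigomega_of_power_bounds:
  fixes f :: "nat \<Rightarrow> real" and n :: "nat \<Rightarrow> nat"
  assumes "d \<le> k - 1" "1 \<le> k" "0 < C" "\<And>i. 0 < n i"
    and f: "\<And>i. 1 / real (n i) ^ d \<le> f i" "\<And>i. f i \<le> C / real (n i) ^ d"
  shows "f \<in> \<Theta>(\<lambda>i. 1 / real (n i) ^ d)"
    and "f \<in> \<Omega>(\<lambda>i. real (n i) powr (1 - real k))"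
proof -
  have "0 \<le> f i" for i
    by (rule order_trans[OF _ f(1)]) simp
  then show "f \<in> \<Theta>(\<lambda>i. 1 / real (n i) ^ d)"
    using f assms(3) by (intro bigthetaI'[of 1 C]) auto
  have "real (n i) powr (1 - real k) \<le> f i" for i
  proof -
    have n: "1 \<le> real (n i)" using assms(4)[of i] by simp
    then have "real (n i) powr (1 - real k) \<le> real (n i) powr (- real d)"
      using assms(1,2) by (intro powr_mono) auto
    also have "\<dots> = 1 / real (n i) ^ d"
      using n by (simp add: powr_minus powr_realpow divide_inverse)
    finally show ?thesis using f(1)[of i] by linarith
  qed
  with \<open>\<And>i. 0 \<le> f i\<close> show "f \<in> \<Omega>(\<lambda>i. real (n i) powr (1 - real k))"
    by (intro landau_omega.bigI[of 1]) auto
qed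

theorem theorem7:
  fixes k :: nat
  assumes "k \<ge> 2"
  shows "\<exists>(G :: nat \<Rightarrow> nat ugraph) (H :: nat ugraph) (d :: nat) (c :: real).
    (\<forall>i. simple_graph (G i)) \<and>
    filterlim (\<lambda>i. card (verts (G i))) at_top sequentially \<and>
    simple_graph H \<and> connected_graph H \<and> card (verts H) = k \<and>
    (3 \<le> k \<longrightarrow> 1 \<le> d) \<and>
    (\<lambda>i. frequency H (G i)) \<in> \<Theta>(\<lambda>i. 1 / real (card (verts (G i))) ^ d) \<and>
    (\<lambda>i. frequency H (G i)) \<in> \<Omega>(\<lambda>i. real (card (verts (G i))) powr (1 - real k)) \<and>
    c > 0 \<and>
    (\<forall>i R A. sampling_algorithm k R A \<longrightarrow>
       expected_calls (G i) H R A \<ge> ennreal (c / frequency H (G i)))"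
proof -
  let ?K = "4 * 2 ^ 2 ^ k :: real"
  \<comment> \<open>Both cases are brought into one form: \<open>F\<close> is the set of removed
    edges and the frequency has order \<open>n ^ d\<close> in the denominator, with
    \<open>d = 2\<close> for \<open>3 \<le> k\<close> and \<open>d = 0\<close> for
    \<open>k = 2\<close>.\<close>
  have "\<exists>F d C. connected_graph (complete_minus k F) \<and> d \<le> k - 1 \<and> (3 \<le> k \<longrightarrow> 1 \<le> d) \<and> 0 < C \<and>
      (\<forall>n\<ge>2 * k + 2. let p = frequency (complete_minus k F) (complete_minus n F) in
         1 / real n ^ d \<le> p \<and> p \<le> C / real n ^ d \<and>
         (\<forall>T\<in>ktrees k. measure (sample (complete_minus n F) T)
            (Collect (is_hit (complete_minus n F) (complete_minus k F))) \<le> ?K * p))"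
  proof (cases "3 \<le> k")
    case True
    have "connected_graph (complete_minus k {{0, 1}})"
      using True connected_induced_complete_minus_edge[of "{..<k}" k 0 1]
        induced_verts[OF simple_graph_complete_minus, of k "{{0, 1}}"] by simp
    with True show ?thesis
      using frequency_complete_minus_edge_bounds[OF True]
      by (intro exI[of _ "{{0, 1}}"] exI[of _ "2 :: nat"] exI[of _ "2 * real k ^ 2"])
         (auto simp: Let_def simp del: One_nat_def intro!: prob_hit_complete_minus_edge_le)
  next
    case False
    have "connected_graph (complete_minus k {})"
      using assms connected_induced_complete[of "{..<k}" k]
        induced_verts[OF simple_graph_complete_minus, of k "{}"] by (simp add: lessThan_empty_iff)
    \<comment> \<open>Here the frequency is 1, so the trivial bound on a probability
      suffices.\<close>
    moreover have "measure (sample (complete_minus n {}) T) S \<le> ?K" for n T S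
    proof -
      have "(1 :: real) \<le> ?K"
        using one_le_power[of "2 :: real" "2 ^ k"] by linarith
      then show ?thesis
        using measure_pmf.prob_le_1 order_trans by blast
    qed
    ultimately show ?thesis
      using False assms frequency_complete[of k]
      by (intro exI[of _ "{}"] exI[of _ "0 :: nat"] exI[of _ "1 :: real"]) (auto simp: Let_def)
  qed
  then obtain F d C where conn: "connected_graph (complete_minus k F)"
    and d: "d \<le> k - 1" "3 \<le> k \<longrightarrow> 1 \<le> d" and C: "0 < C"
    and bounds: "\<And>n. 2 * k + 2 \<le> n \<Longrightarrow>
        1 / real n ^ d \<le> frequency (complete_minus k F) (complete_minus n F) \<and>
        frequency (complete_minus k F) (complete_minus n F) \<le> C / real n ^ d"
    and hit: "\<And>n T. 2 * k + 2 \<le> n \<Longrightarrow> T \<in> ktrees k \<Longrightarrow>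
        measure (sample (complete_minus n F) T)
          (Collect (is_hit (complete_minus n F) (complete_minus k F))) \<le>
        ?K * frequency (complete_minus k F) (complete_minus n F)"
    unfolding Let_def by metis
  \<comment> \<open>The offset keeps every \<open>n i\<close> in the range of the binomial
    estimate.\<close>
  define n where "n i = i + 2 * k + 2" for i
  define p where "p i = frequency (complete_minus k F) (complete_minus (n i) F)" for i
  have p: "1 / real (n i) ^ d \<le> p i" "p i \<le> C / real (n i) ^ d" for i
    unfolding p_def using bounds[of "n i"] by (auto simp: n_def)
  have p_pos: "0 < p i" for i
    by (rule less_le_trans[OF _ p(1)]) (simp add: n_def)
  have theta: "p \<in> \<Theta>(\<lambda>i. 1 / real (n i) ^ d)"
    and omega: "p \<in> \<Omega>(\<lambda>i. real (n i) powr (1 - real k))"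
    using bigtheta_bigomega_of_power_bounds[of d k C n p] d(1) C assms p by (auto simp: n_def)
  have lim: "filterlim n at_top sequentially"
    by (rule filterlim_at_top_mono[OF filterlim_ident]) (simp add: n_def)
  \<comment> \<open>The bound on hits gives \<open>q = ?K * p i\<close>, hence the constant
    \<open>1 / (4 * ?K)\<close>, which is independent of \<open>i\<close>.\<close>
  have calls: "ennreal (1 / (4 * ?K) / p i) \<le> expected_calls (complete_minus (n i) F) (complete_minus k F) R A"
    if "sampling_algorithm k R A" for i R A
    using expected_calls_ge[OF that simple_graph_complete_minus, of "?K * p i" "n i" F "complete_minus k F"]
      p_pos hit[of "n i"] by (simp add: p_def n_def mult.assoc)
  have "p = (\<lambda>i. frequency (complete_minus k F) (complete_minus (n i) F))"
    by (simp add: p_def fun_eq_iff)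
  with conn d(2) theta omega lim calls show ?thesis
    by (intro exI[of _ "\<lambda>i. complete_minus (n i) F"] exI[of _ "complete_minus k F"] exI[of _ d]
        exI[of _ "1 / (4 * ?K)"])
       (auto simp: simple_graph_complete_minus)
qed

end
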